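(* For each $n\ge 1$ let $D_{2n}=\langle a,b \mid a^n,\ b^2,\ abab\rangle$ be the dihedral group of order $2n$, and let $S$ be a subset of $D_{2n}$ chosen uniformly at random among all $2^{2n}$ subsets. Then \[ \mathbb{P}\big(|S+S|=|S-S|\big)\longrightarrow 1\quad\text{as } n\to\infty . \]
   Context: The group operation of $D_{2n}$ is written as juxtaposition; for $S\subseteq D_{2n}$ the sumset is $S+S=\{st : s,t\in S\}$ and the difference set is $S-S=\{st^{-1} : s,t\in S\}$. *)

theory Defs
  imports "HOL-Probability.Probability" "HOL-Algebra.Generated_Groups"
begin

text \<open>The dihedral group of order \<open>2 * n\<close>: the pair \<open>(i, e)\<close> stands for \<open>a^i * b^e\<close>, and
  \<open>b * a^j = a^(-j) * b\<close>.  It is a group only for \<open>n \<ge> 1\<close>; for \<open>n = 0\<close> the carrier is empty.\<close>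

definition dihedral :: "nat \<Rightarrow> (int \<times> bool) monoid" where
  "dihedral n =
    \<lparr>carrier = {0..<int n} \<times> UNIV,
     monoid.mult = (\<lambda>(i, e) (j, f). ((i + (if e then - j else j)) mod int n, e \<noteq> f)),
     one = (0, False)\<rparr>"

definition dihedral_a :: "nat \<Rightarrow> int \<times> bool" where
  "dihedral_a n = (1 mod int n, False)"

definition dihedral_b :: "int \<times> bool" where
  "dihedral_b = (0, True)"

text \<open>The facts up to \<open>dihedral_universal\<close> show that, for \<open>n \<ge> 1\<close>, this model is the group of
  order \<open>2 * n\<close> presented by \<open>\<langle>a, b | a^n, b^2, abab\<rangle>\<close>.\<close>

lemma carrier_dihedral: "carrier (dihedral n) = {0..<int n} \<times> UNIV"
  by (simp add: dihedral_def)

lemma one_dihedral: "\<one>\<^bsub>dihedral n\<^esub> = (0, False)"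
  by (simp add: dihedral_def)

lemma mult_dihedral:
  "(i, e) \<otimes>\<^bsub>dihedral n\<^esub> (j, f) = ((i + (if e then - j else j)) mod int n, e \<noteq> f)"
  by (simp add: dihedral_def)

lemma order_dihedral: "order (dihedral n) = 2 * n"
  by (simp add: order_def carrier_dihedral card_cartesian_product)

lemma group_dihedral:
  assumes "n \<ge> 1"
  shows "group (dihedral n)"
proof (rule groupI)
  fix x y z
  assume "x \<in> carrier (dihedral n)" "y \<in> carrier (dihedral n)" "z \<in> carrier (dihedral n)"
  then show "x \<otimes>\<^bsub>dihedral n\<^esub> y \<otimes>\<^bsub>dihedral n\<^esub> z
      = x \<otimes>\<^bsub>dihedral n\<^esub> (y \<otimes>\<^bsub>dihedral n\<^esub> z)"
    by (cases x; cases y; cases z) (auto simp: mult_dihedral mod_simps algebra_simps)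
next
  fix x
  assume x: "x \<in> carrier (dihedral n)"
  obtain i e where [simp]: "x = (i, e)" by (cases x)
  show "\<exists>y\<in>carrier (dihedral n). y \<otimes>\<^bsub>dihedral n\<^esub> x = \<one>\<^bsub>dihedral n\<^esub>"
    using assms x
    by (intro bexI[of _ "(if e then i else (- i) mod int n, e)"])
      (auto simp: mult_dihedral one_dihedral carrier_dihedral mod_simps)
qed (use assms in \<open>auto simp: mult_dihedral one_dihedral carrier_dihedral\<close>)

lemma dihedral_gens_closed:
  assumes "n \<ge> 1"
  shows "dihedral_a n \<in> carrier (dihedral n)" "dihedral_b \<in> carrier (dihedral n)"
  using assms by (auto simp: dihedral_a_def dihedral_b_def carrier_dihedral)

lemma dihedral_a_pow: "dihedral_a n [^]\<^bsub>dihedral n\<^esub> (k::nat) = (int k mod int n, False)"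
  by (induction k)
    (auto simp: dihedral_a_def one_dihedral mult_dihedral mod_simps algebra_simps)

lemma dihedral_relations:
  "dihedral_a n [^]\<^bsub>dihedral n\<^esub> n = \<one>\<^bsub>dihedral n\<^esub>"
  "dihedral_b [^]\<^bsub>dihedral n\<^esub> (2::nat) = \<one>\<^bsub>dihedral n\<^esub>"
  "dihedral_a n \<otimes>\<^bsub>dihedral n\<^esub> dihedral_b \<otimes>\<^bsub>dihedral n\<^esub> dihedral_a n \<otimes>\<^bsub>dihedral n\<^esub> dihedral_b
    = \<one>\<^bsub>dihedral n\<^esub>"
proof -
  show "dihedral_a n [^]\<^bsub>dihedral n\<^esub> n = \<one>\<^bsub>dihedral n\<^esub>"
    by (simp add: dihedral_a_pow one_dihedral)
qed (auto simp: one_dihedral numeral_2_eq_2 nat_pow_def dihedral_a_def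
      dihedral_b_def mult_dihedral mod_simps)

lemma dihedral_decomp:
  assumes "x \<in> carrier (dihedral n)"
  shows "x = dihedral_a n [^]\<^bsub>dihedral n\<^esub> nat (fst x) \<otimes>\<^bsub>dihedral n\<^esub>
    (if snd x then dihedral_b else \<one>\<^bsub>dihedral n\<^esub>)"
  using assms
  by (cases x) (auto simp: dihedral_a_pow dihedral_b_def one_dihedral mult_dihedral carrier_dihedral)

lemma generate_dihedral:
  assumes "n \<ge> 1"
  shows "generate (dihedral n) {dihedral_a n, dihedral_b} = carrier (dihedral n)"
proof
  interpret group "dihedral n" by (rule group_dihedral[OF assms])
  show "generate (dihedral n) {dihedral_a n, dihedral_b} \<subseteq> carrier (dihedral n)"
    using dihedral_gens_closed[OF assms] by (intro generate_incl) auto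
  have pow: "dihedral_a n [^]\<^bsub>dihedral n\<^esub> k \<in> generate (dihedral n) {dihedral_a n, dihedral_b}"
    for k :: nat
    by (induction k) (auto intro: generate.intros)
  show "carrier (dihedral n) \<subseteq> generate (dihedral n) {dihedral_a n, dihedral_b}"
  proof
    fix x assume "x \<in> carrier (dihedral n)"
    then show "x \<in> generate (dihedral n) {dihedral_a n, dihedral_b}"
      by (subst dihedral_decomp) (auto intro!: generate.eng pow intro: generate.intros)
  qed
qed

theorem dihedral_universal:
  fixes H :: "('h, 'k) monoid_scheme" (structure)
  assumes n: "n \<ge> 1" and "group H"
    and x: "x \<in> carrier H" and y: "y \<in> carrier H"
    and xn: "x [^] n = \<one>" and y2: "y [^] (2::nat) = \<one>" and xyxy: "x \<otimes> y \<otimes> x \<otimes> y = \<one>"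
  shows "\<exists>!h. h \<in> hom (dihedral n) H \<and> h \<in> extensional (carrier (dihedral n)) \<and>
    h (dihedral_a n) = x \<and> h dihedral_b = y"
proof -
  interpret H: group H by fact
  interpret D: group "dihedral n" by (rule group_dihedral[OF n])
  have per: "x [^] (i mod int n) = x [^] i" for i :: int
  proof -
    have "x [^] i = x [^] (int n * (i div int n) + i mod int n)" by simp
    also have "\<dots> = (x [^] int n) [^] (i div int n) \<otimes> x [^] (i mod int n)"
      using x by (simp only: H.int_pow_mult H.int_pow_pow)
    also have "x [^] int n = \<one>" using xn by (simp add: int_pow_int)
    finally show ?thesis using x by simp
  qed
  have yy: "y \<otimes> y = \<one>" using y2 y by (simp add: numeral_2_eq_2)
  have yinv: "inv y = y" using yy y by (metis H.inv_equality)
  have conj1: "y \<otimes> x \<otimes> y = inv x"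
    using xyxy x y by (metis H.inv_comm H.inv_equality H.m_assoc H.m_closed)
  have conjn: "y \<otimes> x [^] (j::int) \<otimes> y = x [^] (- j)" for j
  proof -
    have "(\<lambda>z. y \<otimes> z \<otimes> y) \<in> hom H H"
    proof (rule homI)
      fix u v assume "u \<in> carrier H" "v \<in> carrier H"
      then show "y \<otimes> (u \<otimes> v) \<otimes> y = y \<otimes> u \<otimes> y \<otimes> (y \<otimes> v \<otimes> y)"
        using y yy by (metis H.m_assoc H.m_closed H.l_one)
    qed (use y in auto)
    then have "y \<otimes> x [^] j \<otimes> y = (y \<otimes> x \<otimes> y) [^] j"
      using hom_int_pow[OF _ x H.is_group H.is_group] by blast
    then show ?thesis using x by (simp add: conj1 H.int_pow_inv H.int_pow_neg)
  qed
  have swap: "y \<otimes> x [^] (j::int) = x [^] (- j) \<otimes> y" for j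
    using conjn[of j] x y yy
    by (metis H.int_pow_closed H.m_assoc H.m_closed H.r_one)
  define h where "h = restrict (\<lambda>(i::int, e). x [^] i \<otimes> (if e then y else \<one>)) (carrier (dihedral n))"
  have h_hom: "h \<in> hom (dihedral n) H"
  proof (rule homI)
    fix u v assume uv: "u \<in> carrier (dihedral n)" "v \<in> carrier (dihedral n)"
    obtain i e j f where [simp]: "u = (i, e)" "v = (j, f)" by (cases u; cases v)
    have c: "u \<otimes>\<^bsub>dihedral n\<^esub> v \<in> carrier (dihedral n)" using uv by simp
    have "h (u \<otimes>\<^bsub>dihedral n\<^esub> v) = x [^] (i + (if e then - j else j)) \<otimes> (if e \<noteq> f then y else \<one>)"
      using c by (simp add: h_def mult_dihedral per)
    also have "\<dots> = (x [^] i \<otimes> (if e then y else \<one>)) \<otimes> (x [^] j \<otimes> (if f then y else \<one>))"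
    proof (cases e)
      case False
      then show ?thesis using x y by (simp add: H.int_pow_mult H.m_assoc)
    next
      case True
      have "x [^] i \<otimes> y \<otimes> (x [^] j \<otimes> z) = x [^] i \<otimes> (x [^] (- j) \<otimes> (y \<otimes> z))"
        if "z \<in> carrier H" for z
        using that x y swap[of j] by (metis H.int_pow_closed H.m_assoc H.m_closed)
      moreover have "x [^] (i - j) = x [^] i \<otimes> x [^] (- j)"
        using H.int_pow_mult[OF x, of i "- j"] by simp
      ultimately show ?thesis using True x y yy by (simp add: H.m_assoc)
    qed
    also have "\<dots> = h u \<otimes> h v" using uv by (simp add: h_def)
    finally show "h (u \<otimes>\<^bsub>dihedral n\<^esub> v) = h u \<otimes> h v" .
  qed (use x y in \<open>auto simp: h_def split: prod.splits\<close>)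
  have ha: "h (dihedral_a n) = x"
    using dihedral_gens_closed[OF n] x by (simp add: h_def dihedral_a_def per)
  have hb: "h dihedral_b = y"
    using dihedral_gens_closed[OF n] y by (simp add: h_def dihedral_b_def)
  show ?thesis
  proof (rule ex1I[of _ h])
    show "h \<in> hom (dihedral n) H \<and> h \<in> extensional (carrier (dihedral n)) \<and>
        h (dihedral_a n) = x \<and> h dihedral_b = y"
      using h_hom ha hb by (simp add: h_def)
  next
    fix g assume g: "g \<in> hom (dihedral n) H \<and> g \<in> extensional (carrier (dihedral n)) \<and>
        g (dihedral_a n) = x \<and> g dihedral_b = y"
    have val: "k u = x [^] nat (fst u) \<otimes> (if snd u then y else \<one>)"
      if k: "k \<in> hom (dihedral n) H" "k (dihedral_a n) = x" "k dihedral_b = y"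
        and u: "u \<in> carrier (dihedral n)" for k u
    proof -
      interpret k: group_hom "dihedral n" H k
        by unfold_locales (rule k)
      show ?thesis
        using k dihedral_gens_closed[OF n]
        by (subst dihedral_decomp[OF u]) (auto simp: k.hom_nat_pow)
    qed
    show "g = h"
    proof (rule extensionalityI[where A = "carrier (dihedral n)"])
      fix u assume "u \<in> carrier (dihedral n)"
      then show "g u = h u" using val[of g u] val[of h u] g h_hom ha hb by simp
    qed (use g in \<open>auto simp: h_def\<close>)
  qed
qed

definition sumset :: "('a, 'b) monoid_scheme \<Rightarrow> 'a set \<Rightarrow> 'a set" where
  "sumset G S = {s \<otimes>\<^bsub>G\<^esub> t | s t. s \<in> S \<and> t \<in> S}"

definition diffset :: "('a, 'b) monoid_scheme \<Rightarrow> 'a set \<Rightarrow> 'a set" where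
  "diffset G S = {s \<otimes>\<^bsub>G\<^esub> inv\<^bsub>G\<^esub> t | s t. s \<in> S \<and> t \<in> S}"

lemma sumset_eq_set_mult: "sumset G S = S <#>\<^bsub>G\<^esub> S"
  by (auto simp: sumset_def set_mult_def)

lemma diffset_eq_set_mult: "diffset G S = S <#>\<^bsub>G\<^esub> (set_inv\<^bsub>G\<^esub> S)"
  by (auto simp: diffset_def set_mult_def SET_INV_def)

end

theory Submission
  imports Defs "HOL-Real_Asymp.Real_Asymp"
begin

text \<open>In every finite group \<open>G\<close> of order \<open>N\<close>, an element \<open>g\<close> is missed by \<open>S + S\<close> or by \<open>S - S\<close>
  only if \<open>S\<close> contains no pair \<open>{s, f s}\<close>, where \<open>f\<close> is the permutation \<open>s \<mapsto> s\<^sup>-\<^sup>1 g\<close> or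
  \<open>s \<mapsto> g s\<close>. Each such pair meets at most three of them (those starting at \<open>s\<close>, \<open>f s\<close> and
  \<open>f\<^sup>-\<^sup>1 s\<close>), so about \<open>N/3\<close> of the pairs are disjoint and \<open>g\<close> is missed with probability at most
  \<open>(3/4)^(N/3)\<close>. By the union bound \<open>S + S = G = S - S\<close> asymptotically almost surely.\<close>

text \<open>The ambient set \<open>U\<close> and the set \<open>A\<close> of starting points are
  separate because the counting induction shrinks them differently: one step deletes at most two
  points from \<open>U\<close> but up to three from \<open>A\<close>.\<close>

definition pair_free :: "'a set \<Rightarrow> 'a set \<Rightarrow> ('a \<Rightarrow> 'a) \<Rightarrow> 'a set set" where
  "pair_free U A f = {S. S \<subseteq> U \<and> (\<forall>s\<in>A. \<not> (s \<in> S \<and> f s \<in> S))}"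

lemma finite_pair_free: "finite U \<Longrightarrow> finite (pair_free U A f)"
  by (rule finite_subset[of _ "Pow U"]) (auto simp: pair_free_def)

text \<open>A member \<open>S\<close> is determined by its trace on \<open>{s, f s}\<close> and by
  the remainder. The trace is any subset but the full pair: three choices, or only the empty set at
  a fixed point.\<close>

lemma card_pair_free_remove:
  assumes "finite U" "s \<in> U" "f s \<in> U" "s \<in> A"
    and A': "A' \<subseteq> A"
  shows "card (pair_free U A f)
    \<le> (if f s = s then 1 else 3) * card (pair_free (U - {s, f s}) A' f)"
proof -
  define T where "T = (if f s = s then {{}} else {{}, {s}, {f s}})"
  let ?P = "pair_free (U - {s, f s}) A' f"
  have "pair_free U A f \<subseteq> (\<lambda>(X, Y). X \<union> Y) ` (T \<times> ?P)"
  proof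
    fix S assume S: "S \<in> pair_free U A f"
    have "S - {s, f s} \<in> ?P"
      using S A' by (auto simp: pair_free_def)
    moreover have "S \<inter> {s, f s} \<in> T"
      using S \<open>s \<in> A\<close> by (auto simp: pair_free_def T_def)
    moreover have "S = S \<inter> {s, f s} \<union> (S - {s, f s})" by blast
    ultimately show "S \<in> (\<lambda>(X, Y). X \<union> Y) ` (T \<times> ?P)"
      by (metis (no_types, lifting) SigmaI case_prod_conv image_eqI)
  qed
  moreover have fin: "finite (T \<times> ?P)"
    using assms(1) by (auto simp: T_def finite_pair_free)
  ultimately have "card (pair_free U A f) \<le> card (T \<times> ?P)"
    by (simp only: surj_card_le[OF fin])
  also have "\<dots> = card T * card ?P" by (rule card_cartesian_product)
  also have "card T = (if f s = s then 1 else 3)" by (auto simp: T_def)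
  finally show ?thesis .
qed

lemma card_pair_free_le:
  assumes "finite U" "A \<subseteq> U" "inj_on f A" "f ` A \<subseteq> U" "3 * m \<le> card A"
  shows "4 ^ m * card (pair_free U A f) \<le> 3 ^ m * 2 ^ card U"
  using assms
proof (induction m arbitrary: U A)
  case 0
  have "card (pair_free U A f) \<le> card (Pow U)"
    by (rule card_mono) (use 0 in \<open>auto simp: pair_free_def\<close>)
  then show ?case using 0 by (simp add: card_Pow)
next
  case (Suc m)
  from Suc.prems obtain s where s: "s \<in> A" by fastforce
  \<comment> \<open>These are the \<open>t\<close> whose pair \<open>{t, f t}\<close> is disjoint
    from \<open>{s, f s}\<close>; the remaining case \<open>f t = f s\<close> is excluded by
    injectivity.\<close>
  define A' where "A' = {t \<in> A. t \<noteq> s \<and> t \<noteq> f s \<and> f t \<noteq> s}"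
  define U' where "U' = U - {s, f s}"
  have finA: "finite A" using Suc.prems finite_subset by blast
  have "card (A - A') \<le> 3"
  proof -
    have "A - A' \<subseteq> {s, f s} \<union> (f -` {s} \<inter> A)" by (auto simp: A'_def)
    moreover have "card (f -` {s} \<inter> A) \<le> 1"
      using card_vimage_inj_on_le[OF Suc.prems(3), of "{s}"] by simp
    moreover have "card {s, f s} \<le> 2" by (simp add: card_insert_if)
    ultimately show ?thesis
      using card_mono[of "{s, f s} \<union> (f -` {s} \<inter> A)" "A - A'"]
        card_Un_le[of "{s, f s}" "f -` {s} \<inter> A"] finA by simp
  qed
  moreover have "card (A - A') = card A - card A'"
    using finA by (intro card_Diff_subset) (auto simp: A'_def)
  ultimately have "3 * m \<le> card A'" using Suc.prems(5) by simp
  moreover have "f ` A' \<subseteq> U'"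
    using Suc.prems s by (auto simp: A'_def U'_def inj_on_def)
  moreover have "inj_on f A'"
    using Suc.prems(3) by (rule inj_on_subset) (auto simp: A'_def)
  ultimately have IH: "4 ^ m * card (pair_free U' A' f) \<le> 3 ^ m * 2 ^ card U'"
    using Suc.prems by (intro Suc.IH) (auto simp: A'_def U'_def)
  have sU: "s \<in> U" "f s \<in> U" using s Suc.prems by auto
  have remove: "card (pair_free U A f) \<le> (if f s = s then 1 else 3) * card (pair_free U' A' f)"
    unfolding U'_def by (rule card_pair_free_remove) (use Suc.prems s in \<open>auto simp: A'_def\<close>)
  have cardU': "card U = card {s, f s} + card U'"
    unfolding U'_def using Suc.prems(1) sU
    by (metis Diff_subset card_Diff_subset card_mono empty_subsetI finite.emptyI finite.insertI
        insert_subset le_add_diff_inverse)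
  show ?case
  proof (cases "f s = s")
    case True
    then have "4 ^ Suc m * card (pair_free U A f) \<le> 4 * (4 ^ m * card (pair_free U' A' f))"
      using remove by simp
    also have "\<dots> \<le> 4 * (3 ^ m * 2 ^ card U')" using IH by simp
    \<comment> \<open>At a fixed point \<open>U\<close> loses a single element, so the claim reduces
      to 4 \<le> 3 * 2.\<close>
    also have "\<dots> \<le> 3 ^ Suc m * 2 ^ card U" using True cardU' by simp
    finally show ?thesis .
  next
    case False
    then have "4 ^ Suc m * card (pair_free U A f) \<le> 4 ^ Suc m * (3 * card (pair_free U' A' f))"
      using remove by simp
    also have "\<dots> = 12 * (4 ^ m * card (pair_free U' A' f))" by simp
    also have "\<dots> \<le> 12 * (3 ^ m * 2 ^ card U')" using IH by simp
    also have "\<dots> = 3 ^ Suc m * 2 ^ card U" using False cardU' by simp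
    finally show ?thesis .
  qed
qed

lemma prob_pair_free_le:
  assumes "finite U" "inj_on f U" "f ` U \<subseteq> U" "3 * m \<le> card U"
  shows "measure_pmf.prob (pmf_of_set (Pow U)) (pair_free U U f) \<le> (3 / 4) ^ m"
proof -
  have "measure_pmf.prob (pmf_of_set (Pow U)) (pair_free U U f)
      = card (pair_free U U f) / 2 ^ card U"
    using assms(1)
    by (subst measure_pmf_of_set) (auto simp: card_Pow pair_free_def intro!: arg_cong[of _ _ card])
  moreover have "4 ^ m * real (card (pair_free U U f)) \<le> 3 ^ m * 2 ^ card U"
    using card_pair_free_le[OF assms(1) subset_refl assms(2-4)]
    by (metis (mono_tags, lifting) of_nat_le_iff of_nat_mult of_nat_numeral of_nat_power)
  ultimately show ?thesis by (simp add: power_divide divide_le_eq le_divide_eq mult.commute)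
qed

context group
begin

text \<open>Union bound: the factor \<open>2 * order G\<close> counts the elements \<open>g\<close>
  and the two ways of missing each, collected in \<open>?B g\<close>.\<close>

lemma prob_sumset_diffset_ne_carrier_le:
  assumes fin: "finite (carrier G)" and m: "3 * m \<le> order G"
  shows "measure_pmf.prob (pmf_of_set (Pow (carrier G)))
    {S. \<not> (sumset G S = carrier G \<and> diffset G S = carrier G)} \<le> 2 * order G * (3 / 4) ^ m"
proof -
  let ?M = "pmf_of_set (Pow (carrier G))"
  let ?P = "\<lambda>f. pair_free (carrier G) (carrier G) f"
  let ?B = "\<lambda>g. ?P (\<lambda>s. inv s \<otimes> g) \<union> ?P (\<lambda>t. g \<otimes> t)"
  have sum: "S \<in> ?P (\<lambda>s. inv s \<otimes> g)"
    if "S \<subseteq> carrier G" "g \<in> carrier G" "g \<notin> sumset G S" for S g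
  proof -
    have "s \<otimes> (inv s \<otimes> g) = g" if "s \<in> carrier G" for s
      using that \<open>g \<in> carrier G\<close> by (simp add: m_assoc[symmetric])
    then show ?thesis
      using that by (fastforce simp: pair_free_def sumset_def)
  qed
  \<comment> \<open>For \<open>g = \<one>\<close> every point is fixed by
    \<open>\<lambda>t. g \<otimes> t\<close> and the pairs degenerate to singletons, so the
    fixed-point case of the count is really used.\<close>
  have diff: "S \<in> ?P (\<lambda>t. g \<otimes> t)"
    if "S \<subseteq> carrier G" "g \<in> carrier G" "g \<notin> diffset G S" for S g
  proof -
    have "g \<otimes> t \<otimes> inv t = g" if "t \<in> carrier G" for t
      using that \<open>g \<in> carrier G\<close> by (simp add: m_assoc)
    then show ?thesis
      using that by (fastforce simp: pair_free_def diffset_def)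
  qed
  have prob_B: "measure_pmf.prob ?M (?B g) \<le> 2 * (3 / 4) ^ m" if g: "g \<in> carrier G" for g
  proof -
    have "measure_pmf.prob ?M (?B g)
        \<le> measure_pmf.prob ?M (?P (\<lambda>s. inv s \<otimes> g)) + measure_pmf.prob ?M (?P (\<lambda>t. g \<otimes> t))"
      by (rule measure_Un_le) auto
    also have "\<dots> \<le> (3 / 4) ^ m + (3 / 4) ^ m"
      using g fin m
      by (intro add_mono prob_pair_free_le)
        (auto simp: order_def inj_on_def dest: inj_onD[OF inv_inj])
    finally show ?thesis by simp
  qed
  have "measure_pmf.prob ?M {S. \<not> (sumset G S = carrier G \<and> diffset G S = carrier G)}
      \<le> measure_pmf.prob ?M (\<Union>g\<in>carrier G. ?B g)"
  \<comment> \<open>The event also contains sets \<open>S\<close> outside the carrier, which need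
    not lie in any \<open>?B g\<close>; intersecting with the support leaves only subsets of the
    carrier.\<close>
  proof (subst (1 2) measure_Int_set_pmf[symmetric], rule measure_pmf.finite_measure_mono)
    have sub: "sumset G S \<subseteq> carrier G" "diffset G S \<subseteq> carrier G" if "S \<subseteq> carrier G" for S
      using that by (auto simp: sumset_def diffset_def)
    show "{S. \<not> (sumset G S = carrier G \<and> diffset G S = carrier G)} \<inter> set_pmf ?M
        \<subseteq> (\<Union>g\<in>carrier G. ?B g) \<inter> set_pmf ?M"
    proof
      fix S assume "S \<in> {S. \<not> (sumset G S = carrier G \<and> diffset G S = carrier G)} \<inter> set_pmf ?M"
      then have ne: "\<not> (sumset G S = carrier G \<and> diffset G S = carrier G)"
        and SM: "S \<in> set_pmf ?M" by auto
      then have S: "S \<subseteq> carrier G" using fin by (simp add: set_pmf_of_set Pow_not_empty)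
      then obtain g where "g \<in> carrier G" "g \<notin> sumset G S \<or> g \<notin> diffset G S"
        using ne sub by blast
      then show "S \<in> (\<Union>g\<in>carrier G. ?B g) \<inter> set_pmf ?M"
        using S SM sum diff by blast
    qed
  qed auto
  also have "\<dots> \<le> (\<Sum>g\<in>carrier G. measure_pmf.prob ?M (?B g))"
    by (rule measure_UNION_le) (use fin in auto)
  also have "\<dots> \<le> (\<Sum>g\<in>carrier G. 2 * (3 / 4) ^ m)"
    by (rule sum_mono) (rule prob_B)
  also have "\<dots> = 2 * order G * (3 / 4) ^ m" by (simp add: order_def)
  finally show ?thesis .
qed

end

theorem theorem2:
  shows "(\<lambda>n. measure_pmf.prob (pmf_of_set (Pow (carrier (dihedral n))))
            {S. card (sumset (dihedral n) S) = card (diffset (dihedral n) S)})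
          \<longlonglongrightarrow> 1"
    (is "?p \<longlonglongrightarrow> 1")
proof (rule tendsto_sandwich)
  \<comment> \<open>The group has order \<open>2 * n\<close>, and \<open>m = n div 2\<close>
    satisfies \<open>3 * m \<le> 2 * n\<close>. The exponent \<open>real n / 2 - 1\<close> bounds
    \<open>n div 2\<close> from below without rounding.\<close>
  show "(\<lambda>n. 1 - 4 * real n * (3 / 4) powr (real n / 2 - 1)) \<longlonglongrightarrow> 1"
    by real_asymp
  show "\<forall>\<^sub>F n in sequentially. 1 - 4 * real n * (3 / 4) powr (real n / 2 - 1) \<le> ?p n"
    using eventually_ge_at_top[of 1]
  proof eventually_elim
    case (elim n)
    let ?G = "dihedral n"
    let ?M = "pmf_of_set (Pow (carrier ?G))"
    let ?E = "{S. sumset ?G S = carrier ?G \<and> diffset ?G S = carrier ?G}"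
    have "measure_pmf.prob ?M (- ?E) \<le> 2 * order ?G * (3 / 4) ^ (n div 2)"
      using group.prob_sumset_diffset_ne_carrier_le[OF group_dihedral[OF elim], of "n div 2"]
      by (simp add: carrier_dihedral order_dihedral Compl_eq)
    also have "(3 / 4) ^ (n div 2) = (3 / 4 :: real) powr real (n div 2)"
      by (simp add: powr_realpow)
    also have "\<dots> \<le> (3 / 4) powr (real n / 2 - 1)"
    proof (rule powr_mono')
      show "real n / 2 - 1 \<le> real (n div 2)" by linarith
    qed auto
    finally have "measure_pmf.prob ?M (- ?E) \<le> 4 * real n * (3 / 4) powr (real n / 2 - 1)"
      by (simp add: order_dihedral mult_left_mono)
    moreover have "measure_pmf.prob ?M (- ?E) = 1 - measure_pmf.prob ?M ?E"
      using measure_pmf.prob_compl[of ?E ?M] by (simp add: Compl_eq_Diff_UNIV)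
    \<comment> \<open>On \<open>?E\<close> both sets are the whole carrier, so their cardinalities
      agree.\<close>
    moreover have "measure_pmf.prob ?M ?E \<le> ?p n"
      by (rule measure_pmf.finite_measure_mono) auto
    ultimately show ?case by linarith
  qed
qed auto

end
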